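(* For every integer $n\ge 3$, \[p_b(C_n)=\begin{cases} \frac{n}{4} & \text{if } n\equiv 0\pmod 8,\\ 2\left\lfloor\frac{n}{8}\right\rfloor+1 & \text{if } n\equiv 1,2,3\pmod 8,\\ 2\left\lfloor\frac{n}{8}\right\rfloor+2 & \text{if } n\equiv 4,5,6,7\pmod 8,\end{cases}\] where $C_n$ is the cycle of order $n$.
   Context: For a graph $G=(V,E)$, a broadcast is a function $f:V\to\{0,\dots,\operatorname{diam}(G)\}$ with $f(v)\le e_G(v)$ (eccentricity) for all $v$. Let $V^+_f=\{v: f(v)>0\}$ and $H_f(u)=\{v\in V^+_f: d_G(u,v)\le f(v)\}$. The cost is $\sigma(f)=\sum_v f(v)$. $f$ is a packing broadcast if $|H_f(u)|\le1$ for every $u\in V$; it is maximal if no packing broadcast $g\ne f$ satisfies $g\ge f$ pointwise. $p_b(G)$ is the minimum cost of a maximal packing broadcast on $G$. *)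

theory Defs
  imports "Graph_Theory.Graph_Theory"
begin

text \<open>
  Following \<^locale>\<open>graph\<close>, an undirected graph is a symmetric digraph. The distance is the
  library's shortest-path cost with unit weights; it takes the value \<open>\<infinity>\<close> between vertices of
  different components.
\<close>

definition graph_dist :: "('a, 'b) pre_digraph \<Rightarrow> 'a \<Rightarrow> 'a \<Rightarrow> ereal" where
  "graph_dist G u v = wf_digraph.\<mu> G (\<lambda>_. 1) u v"

definition eccentricity :: "('a, 'b) pre_digraph \<Rightarrow> 'a \<Rightarrow> ereal" where
  "eccentricity G v = (SUP u \<in> verts G. graph_dist G v u)"

definition graph_diam :: "('a, 'b) pre_digraph \<Rightarrow> ereal" where
  "graph_diam G = (SUP v \<in> verts G. eccentricity G v)"

text \<open>
  A function on the vertex set is represented by a total function of which only the values on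
  \<^term>\<open>verts G\<close> matter; accordingly, functions are compared on \<^term>\<open>verts G\<close> only.
\<close>

definition broadcast :: "('a, 'b) pre_digraph \<Rightarrow> ('a \<Rightarrow> nat) \<Rightarrow> bool" where
  "broadcast G f \<longleftrightarrow>
     (\<forall>v \<in> verts G. ereal (real (f v)) \<le> graph_diam G \<and> ereal (real (f v)) \<le> eccentricity G v)"

definition broadcast_verts :: "('a, 'b) pre_digraph \<Rightarrow> ('a \<Rightarrow> nat) \<Rightarrow> 'a set" where
  "broadcast_verts G f = {v \<in> verts G. f v > 0}"

definition heard :: "('a, 'b) pre_digraph \<Rightarrow> ('a \<Rightarrow> nat) \<Rightarrow> 'a \<Rightarrow> 'a set" where
  "heard G f u = {v \<in> broadcast_verts G f. graph_dist G u v \<le> ereal (real (f v))}"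

definition broadcast_cost :: "('a, 'b) pre_digraph \<Rightarrow> ('a \<Rightarrow> nat) \<Rightarrow> nat" where
  "broadcast_cost G f = (\<Sum>v \<in> verts G. f v)"

definition packing_broadcast :: "('a, 'b) pre_digraph \<Rightarrow> ('a \<Rightarrow> nat) \<Rightarrow> bool" where
  "packing_broadcast G f \<longleftrightarrow> broadcast G f \<and> (\<forall>u \<in> verts G. card (heard G f u) \<le> 1)"

definition maximal_packing_broadcast :: "('a, 'b) pre_digraph \<Rightarrow> ('a \<Rightarrow> nat) \<Rightarrow> bool" where
  "maximal_packing_broadcast G f \<longleftrightarrow> packing_broadcast G f \<and>
     \<not> (\<exists>g. packing_broadcast G g \<and> (\<exists>v \<in> verts G. g v \<noteq> f v) \<and> (\<forall>v \<in> verts G. f v \<le> g v))"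

text \<open>
  On \<^typ>\<open>nat\<close> the infimum of a nonempty set is its minimum, and the infimum of the empty set
  is \<open>0\<close>.
\<close>

definition lower_broadcast_packing_number :: "('a, 'b) pre_digraph \<Rightarrow> nat" where
  "lower_broadcast_packing_number G = Inf {broadcast_cost G f |f. maximal_packing_broadcast G f}"

definition cycle_graph :: "nat \<Rightarrow> nat pair_pre_digraph" where
  "cycle_graph n =
     \<lparr>pverts = {..<n},
      parcs = {(u, v). u < n \<and> v < n \<and> (v = (u + 1) mod n \<or> u = (v + 1) mod n)}\<rparr>"

lemma pair_graph_cycle_graph:
  assumes "n \<ge> 3"
  shows "pair_graph (cycle_graph n)"
proof
  have sub: "parcs (cycle_graph n) \<subseteq> {..<n} \<times> {..<n}"
    by (auto simp: cycle_graph_def)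
  then show "finite (parcs (cycle_graph n))"
    by (rule finite_subset) simp
  show "finite (pverts (cycle_graph n))"
    by (simp add: cycle_graph_def)
  show "fst e \<in> pverts (cycle_graph n)" "snd e \<in> pverts (cycle_graph n)"
    if "e \<in> parcs (cycle_graph n)" for e
    using that by (auto simp: cycle_graph_def)
  show "symmetric (with_proj (cycle_graph n))"
    by (auto simp: symmetric_def sym_def cycle_graph_def)
  show "fst e \<noteq> snd e" if "e \<in> parcs (cycle_graph n)" for e
    using that assms by (auto simp: cycle_graph_def mod_Suc split: if_splits)
qed

end

theory Submission
  imports Defs
begin

text \<open>
  For the lower bound, let \<open>U\<close> be the set of vertices that hear nothing, \<open>k\<close> the number of
  broadcasting vertices and \<open>F\<close> the cost, so that \<open>n \<le> 2F + k + |U|\<close>. By maximality every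
  vertex of \<open>U\<close> has a neighbour outside \<open>U\<close>, and no broadcasting vertex has elements of \<open>U\<close>
  just beyond both ends of its ball. Going around the cycle, \<open>U\<close> is entered as often as it is left,
  say \<open>c\<close> times; hence \<open>|U| \<le> 2c \<le> k \<le> F\<close> and \<open>n \<le> 3F + 2\<lfloor>F/2\<rfloor>\<close>.

  For \<open>n \<ge> 6\<close> the bound is attained by broadcasts of strength 1 at the vertices \<open>8i\<close> and
  \<open>8i + 3\<close>, with up to two further vertices near the end of the cycle; for \<open>n < 6\<close> a single
  broadcast reaching every vertex is optimal.
\<close>

section \<open>Arithmetic of distance and successor on the vertices
  \<open>0, ..., n - 1\<close>\<close>

definition cyc_dist :: "nat \<Rightarrow> nat \<Rightarrow> nat \<Rightarrow> nat" where
  "cyc_dist n u v = min ((u - v) + (v - u)) (n - ((u - v) + (v - u)))"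

definition cyc_succ :: "nat \<Rightarrow> nat \<Rightarrow> nat" where
  "cyc_succ n u = (if Suc u = n then 0 else Suc u)"

lemma cyc_succ_eq_mod: "u < n \<Longrightarrow> (u + 1) mod n = cyc_succ n u"
  by (auto simp: cyc_succ_def)

lemma cyc_succ_less: "u < n \<Longrightarrow> cyc_succ n u < n"
  by (auto simp: cyc_succ_def)

lemma inj_on_cyc_succ: "inj_on (cyc_succ n) {..<n}"
  by (auto simp: inj_on_def cyc_succ_def split: if_splits)

lemma cyc_succ_surj:
  assumes "u < n"
  obtains p where "p < n" "u = cyc_succ n p"
  using assms that[of "if u = 0 then n - 1 else u - 1"] by (cases u) (auto simp: cyc_succ_def)

lemma verts_cycle_graph: "verts (with_proj (cycle_graph n)) = {..<n}"
  by (simp add: cycle_graph_def)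

lemma arcs_cycle_graph:
  "(u, v) \<in> arcs (with_proj (cycle_graph n)) \<longleftrightarrow>
     u < n \<and> v < n \<and> (v = cyc_succ n u \<or> u = cyc_succ n v)"
  by (auto simp: cycle_graph_def cyc_succ_eq_mod[symmetric])

lemma cyc_dist_sym: "cyc_dist n u v = cyc_dist n v u"
  by (simp add: cyc_dist_def add.commute)

lemma cyc_dist_self [simp]: "cyc_dist n u u = 0"
  by (simp add: cyc_dist_def)

lemma cyc_dist_eq_0_iff: "u < n \<Longrightarrow> v < n \<Longrightarrow> cyc_dist n u v = 0 \<longleftrightarrow> u = v"
  by (auto simp: cyc_dist_def min_def)

text \<open>Since subtraction truncates, \<open>(u - v) + (v - u)\<close> is |u - v|. The disjuncts
  stand for the direct arc and for the two ways around past the end of the numbering; later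
  arithmetic proofs start from this linear form.\<close>

lemma cyc_dist_le_iff:
  assumes "u < n" "v < n"
  shows "cyc_dist n u v \<le> r \<longleftrightarrow> u \<le> v + r \<and> v \<le> u + r \<or> n + v \<le> u + r \<or> n + u \<le> v + r"
  using assms by (cases "u \<le> v") (auto simp: cyc_dist_def min_le_iff_disj)

lemma cyc_dist_le_half: "u < n \<Longrightarrow> v < n \<Longrightarrow> cyc_dist n u v \<le> n div 2"
  unfolding cyc_dist_le_iff by presburger

lemma cyc_dist_half_attained:
  assumes "v < n"
  shows "\<exists>u<n. cyc_dist n v u = n div 2"
proof (cases "v + n div 2 < n")
  case True
  then show ?thesis
    by (intro exI[of _ "v + n div 2"]) (auto simp: cyc_dist_def min_def)
next
  case False
  then show ?thesis
    using assms by (intro exI[of _ "v - n div 2"]) (auto simp: cyc_dist_def min_def)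
qed

lemma cyc_dist_step_le:
  assumes "u < n" "v < n" "w < n" "v = cyc_succ n u \<or> u = cyc_succ n v" "cyc_dist n v w \<le> r"
  shows "cyc_dist n u w \<le> Suc r"
  using assms unfolding cyc_dist_le_iff[OF assms(1,3)] cyc_dist_le_iff[OF assms(2,3)] cyc_succ_def
  using [[smt_nat_as_int]] by (smt (verit))

text \<open>One of the two neighbours of \<open>u\<close> begins a shortest arc to \<open>w\<close>.
  By \<open>cyc_dist_step_le\<close> a single step cannot gain more than 1, hence the
  equality.\<close>

lemma cyc_dist_descend:
  assumes "u < n" "w < n" "cyc_dist n u w = Suc d"
  obtains v where "v < n" "v = cyc_succ n u \<or> u = cyc_succ n v" "cyc_dist n v w = d"
proof -
  obtain p where p: "p < n" "u = cyc_succ n p"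
    using cyc_succ_surj[OF assms(1)] .
  note s = cyc_succ_less[OF assms(1)]
  have le: "cyc_dist n u w \<le> Suc d" "\<not> cyc_dist n u w \<le> d"
    using assms by auto
  have "cyc_dist n p w \<le> d \<or> cyc_dist n (cyc_succ n u) w \<le> d"
    using le assms(1,2) unfolding cyc_dist_le_iff[OF p(1) assms(2)] cyc_dist_le_iff[OF s assms(2)]
      cyc_dist_le_iff[OF assms(1,2)]
    using p s unfolding cyc_succ_def using [[smt_nat_as_int]] by (smt (verit))
  then obtain v where v: "v < n" "v = cyc_succ n u \<or> u = cyc_succ n v" "cyc_dist n v w \<le> d"
    using p s by blast
  have "\<not> cyc_dist n v w < d"
    using cyc_dist_step_le[of u n v w "cyc_dist n v w"] v assms by auto
  then show thesis
    using v that by force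
qed

lemma cyc_dist_le_1_cases:
  assumes "u < n" "y < n" "cyc_dist n y u \<le> 1"
  shows "y = u \<or> y = cyc_succ n u \<or> u = cyc_succ n y"
  using assms unfolding cyc_dist_le_iff[OF assms(2,1)] cyc_succ_def
  using [[smt_nat_as_int]] by (smt (verit))

text \<open>\<open>y\<close> is found by walking from \<open>u\<close> towards \<open>w\<close> for
  at most \<open>a\<close> steps. With \<open>a\<close> and \<open>b\<close> as strengths, a
  distance bound between two centres becomes a vertex common to both balls.\<close>

lemma cyc_dist_split:
  assumes "u < n" "w < n" "cyc_dist n u w \<le> a + b"
  shows "\<exists>y<n. cyc_dist n y u \<le> a \<and> cyc_dist n y w \<le> b"
  using assms
proof (induction a arbitrary: u)
  case 0
  then show ?case by (intro exI[of _ u]) auto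
next
  case (Suc a)
  show ?case
  proof (cases "cyc_dist n u w")
    case 0
    then show ?thesis using Suc.prems by (intro exI[of _ u]) auto
  next
    case (Suc d)
    then obtain v where v: "v < n" "v = cyc_succ n u \<or> u = cyc_succ n v" "cyc_dist n v w = d"
      using Suc.prems by (metis cyc_dist_descend)
    then obtain y where y: "y < n" "cyc_dist n y v \<le> a" "cyc_dist n y w \<le> b"
      using Suc.IH[of v] Suc Suc.prems by auto
    have "cyc_dist n u y \<le> Suc a"
      using cyc_dist_step_le[of u n v y a] v y Suc.prems by (simp add: cyc_dist_sym)
    then show ?thesis
      using y by (auto simp: cyc_dist_sym)
  qed
qed

text \<open>A single conditional instead of \<open>mod\<close> keeps this and
  \<open>cyc_left\<close> linear; one wrap is enough for \<open>v < n\<close> and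
  \<open>r \<le> n\<close>.\<close>

definition cyc_right :: "nat \<Rightarrow> nat \<Rightarrow> nat \<Rightarrow> nat" where
  "cyc_right n v r = (if v + r < n then v + r else v + r - n)"

definition cyc_left :: "nat \<Rightarrow> nat \<Rightarrow> nat \<Rightarrow> nat" where
  "cyc_left n v r = (if r \<le> v then v - r else v + n - r)"

text \<open>In the direction of \<open>cyc_succ\<close> a ball can be left only at one end, so
  centre and radius determine the exit vertex. This lets each run of vertices hearing nothing be
  charged to the ball before it.\<close>

lemma cyc_succ_leaves_ball:
  assumes "u < n" "v < n" "cyc_dist n u v \<le> r" "\<not> cyc_dist n (cyc_succ n u) v \<le> r"
  shows "cyc_succ n u = cyc_right n v (Suc r)"
  using assms
  unfolding cyc_dist_le_iff[OF assms(1,2)] cyc_dist_le_iff[OF cyc_succ_less[OF assms(1)] assms(2)]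
  unfolding cyc_succ_def cyc_right_def
  using [[smt_nat_as_int]] by (smt (verit))

lemma cyc_succ_enters_ball:
  assumes "u < n" "v < n" "\<not> cyc_dist n u v \<le> r" "cyc_dist n (cyc_succ n u) v \<le> r"
  shows "u = cyc_left n v (Suc r)"
  using assms
  unfolding cyc_dist_le_iff[OF assms(1,2)] cyc_dist_le_iff[OF cyc_succ_less[OF assms(1)] assms(2)]
  unfolding cyc_succ_def cyc_left_def
  using [[smt_nat_as_int]] by (smt (verit))

lemma cyc_sphere:
  assumes "y < n" "v < n" "cyc_dist n y v \<le> Suc r" "\<not> cyc_dist n y v \<le> r"
  shows "y = cyc_left n v (Suc r) \<or> y = cyc_right n v (Suc r)"
  using assms unfolding cyc_dist_le_iff[OF assms(1,2)] cyc_left_def cyc_right_def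
  using [[smt_nat_as_int]] by (smt (verit))

section \<open>Counting balls and boundaries; arithmetic of the closed formula\<close>

lemma card_cyc_ball_le:
  assumes "v < n"
  shows "card {u. u < n \<and> cyc_dist n u v \<le> r} \<le> 2 * r + 1"
proof -
  \<comment> \<open>The offsets \<open>-r, ..., r\<close> reach the whole ball; they may coincide
    modulo \<open>n\<close> when it wraps onto itself, hence only an upper bound.\<close>
  have "{u. u < n \<and> cyc_dist n u v \<le> r} \<subseteq>
      (\<lambda>i. nat ((int v + i) mod int n)) ` {- int r..int r}"
  proof
    fix u assume "u \<in> {u. u < n \<and> cyc_dist n u v \<le> r}"
    then have u: "u < n" "u \<le> v + r \<and> v \<le> u + r \<or> n + v \<le> u + r \<or> n + u \<le> v + r"
      using assms by (auto simp: cyc_dist_le_iff)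
    \<comment> \<open>The multiples 0, -1 and 1 of \<open>n\<close> match the three disjuncts of
      \<open>cyc_dist_le_iff\<close>, in this order.\<close>
    from u(2) have "int u - int v + 0 * int n \<in> {- int r..int r} \<or>
        int u - int v + (- 1) * int n \<in> {- int r..int r} \<or>
        int u - int v + 1 * int n \<in> {- int r..int r}"
      using u(1) assms by (elim disjE) simp_all
    then obtain k where k: "int u - int v + k * int n \<in> {- int r..int r}"
      by blast
    have "u = nat ((int v + (int u - int v + k * int n)) mod int n)"
      using u(1) by simp
    then show "u \<in> (\<lambda>i. nat ((int v + i) mod int n)) ` {- int r..int r}"
      using k by blast
  qed
  then have "card {u. u < n \<and> cyc_dist n u v \<le> r} \<le> card {- int r..int r}"
    by (rule surj_card_le[rotated]) simp
  then show ?thesis by simp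
qed

text \<open>Both sides count \<open>U\<close> less its overlap with its image, because
  \<open>s\<close> preserves the size of \<open>U\<close>. For the successor map: \<open>U\<close>
  is entered as often as it is left.\<close>

lemma card_inj_boundary_eq:
  assumes "finite U" "inj_on s U"
  shows "card (U - s ` U) = card {u \<in> U. s u \<notin> U}"
proof -
  have "card (U - s ` U) + card (U \<inter> s ` U) = card U"
    using card_Int_Diff[OF assms(1), of "s ` U"] by simp
  moreover have "card (s ` U - U) + card (U \<inter> s ` U) = card (s ` U)"
    using card_Int_Diff[of "s ` U" U] assms(1) by (simp add: Int_commute)
  moreover have "card (s ` U) = card U"
    using assms(2) by (rule card_image)
  moreover have "card (s ` U - U) = card {u \<in> U. s u \<notin> U}"
  proof -
    have "s ` U - U = s ` {u \<in> U. s u \<notin> U}" by auto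
    moreover have "inj_on s {u \<in> U. s u \<notin> U}"
      using assms(2) by (rule inj_on_subset) auto
    ultimately show ?thesis by (simp add: card_image)
  qed
  ultimately show ?thesis by linarith
qed

text \<open>For F = 2h the right side of the assumption is 8h, for F = 2h + 1 it is 8h + 3; this is
  where the thresholds 0 and 3 for \<open>r\<close> come from. If \<open>m < h\<close>, then F is at
  least 2m + 2 anyway.\<close>

lemma cost_bound_of_order_bound:
  fixes F m r :: nat
  assumes "8 * m + r \<le> 3 * F + 2 * (F div 2)"
  shows "2 * m + (if r = 0 then 0 else if r \<le> 3 then 1 else 2) \<le> F"
proof (cases "even F")
  case True
  then obtain h where "F = 2 * h" by (elim evenE)
  then show ?thesis using assms by (cases "m < h") (auto split: if_splits)
next
  case False
  then obtain h where "F = 2 * h + 1" by (elim oddE)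
  then show ?thesis using assms by (cases "m < h") (auto split: if_splits)
qed

lemma cost_formula_eq:
  fixes n :: nat
  shows "(if n mod 8 = 0 then n div 4
     else if n mod 8 \<in> {1, 2, 3} then 2 * (n div 8) + 1
     else 2 * (n div 8) + 2) =
    2 * (n div 8) + (if n mod 8 = 0 then 0 else if n mod 8 \<le> 3 then 1 else 2)"
proof -
  have "n div 4 = 2 * (n div 8)" if "n mod 8 = 0"
    using that by presburger
  moreover have "n mod 8 \<in> {1, 2, 3} \<longleftrightarrow> n mod 8 \<noteq> 0 \<and> n mod 8 \<le> 3"
    by auto
  ultimately show ?thesis by auto
qed

section \<open>Translating walks and broadcasts on the cycle graph into arithmetic\<close>

context
  fixes n :: nat
  assumes n3: "n \<ge> 3"
begin

interpretation C: pair_graph "cycle_graph n"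
  using pair_graph_cycle_graph[OF n3] .

lemma cyc_dist_le_length:
  assumes "C.awalk u p v"
  shows "cyc_dist n u v \<le> length p"
  using assms
proof (induction p arbitrary: u)
  case Nil
  then show ?case by (simp add: C.awalk_Nil_iff)
next
  case (Cons e p)
  obtain a b where e: "e = (a, b)" by (cases e)
  from Cons.prems have *: "(u, b) \<in> arcs (with_proj (cycle_graph n))" "C.awalk b p v"
    unfolding e by (auto simp: C.awalk_Cons_iff)
  have "v < n"
    using C.awalk_last_in_verts[OF *(2)] by (simp add: cycle_graph_def)
  then have "cyc_dist n u v \<le> Suc (cyc_dist n b v)"
    using *(1) unfolding arcs_cycle_graph by (intro cyc_dist_step_le[where v = b]) auto
  with Cons.IH[OF *(2)] show ?case by simp
qed

text \<open>Repeatedly stepping to a closer neighbour gives such a walk. With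
  \<open>cyc_dist_le_length\<close> this identifies the graph distance.\<close>

lemma awalk_of_length_cyc_dist:
  assumes "u < n" "v < n"
  shows "\<exists>p. C.awalk u p v \<and> length p = cyc_dist n u v"
  using assms
proof (induction "cyc_dist n u v" arbitrary: u)
  case 0
  then have "u = v" by (metis cyc_dist_eq_0_iff)
  then show ?case
    using 0 by (intro exI[of _ "[]"]) (simp add: C.awalk_Nil_iff, simp add: cycle_graph_def)
next
  case (Suc d)
  obtain w where w: "w < n" "w = cyc_succ n u \<or> u = cyc_succ n w" "cyc_dist n w v = d"
    using Suc.prems Suc.hyps(2) by (metis cyc_dist_descend)
  obtain p where p: "C.awalk w p v" "length p = d"
    using Suc.hyps(1)[of w] w Suc.prems by auto
  have "(u, w) \<in> arcs (with_proj (cycle_graph n))"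
    unfolding arcs_cycle_graph using w Suc.prems by auto
  then show ?case
    using p Suc.hyps(2) by (intro exI[of _ "(u, w) # p"]) (auto simp: C.awalk_Cons_iff)
qed

lemma graph_dist_cycle_graph:
  assumes "u < n" "v < n"
  shows "graph_dist (with_proj (cycle_graph n)) u v = ereal (real (cyc_dist n u v))"
proof (rule antisym)
  have cost: "C.awalk_cost (\<lambda>_. 1) p = real (length p)" for p
    by (induction p) auto
  obtain p where p: "C.awalk u p v" "length p = cyc_dist n u v"
    using awalk_of_length_cyc_dist[OF assms] by blast
  show "graph_dist (with_proj (cycle_graph n)) u v \<le> ereal (real (cyc_dist n u v))"
    using C.min_cost_le_walk_cost[OF p(1), of "\<lambda>_. 1"] p(2)
    by (simp add: graph_dist_def cost)
  show "ereal (real (cyc_dist n u v)) \<le> graph_dist (with_proj (cycle_graph n)) u v"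
    unfolding graph_dist_def C.\<mu>_def
    by (intro INF_greatest) (auto simp: cost cyc_dist_le_length)
qed

lemma eccentricity_cycle_graph:
  assumes "v < n"
  shows "eccentricity (with_proj (cycle_graph n)) v = ereal (real (n div 2))"
  unfolding eccentricity_def verts_cycle_graph
proof (rule antisym)
  show "(SUP u\<in>{..<n}. graph_dist (with_proj (cycle_graph n)) v u) \<le> ereal (real (n div 2))"
    using assms by (intro SUP_least) (simp add: graph_dist_cycle_graph cyc_dist_le_half)
  obtain u where "u < n" "cyc_dist n v u = n div 2"
    using cyc_dist_half_attained[OF assms] by blast
  then show "ereal (real (n div 2)) \<le> (SUP u\<in>{..<n}. graph_dist (with_proj (cycle_graph n)) v u)"
    using assms by (intro SUP_upper2[of u]) (auto simp: graph_dist_cycle_graph)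
qed

lemma graph_diam_cycle_graph:
  "graph_diam (with_proj (cycle_graph n)) = ereal (real (n div 2))"
proof -
  have "{..<n} \<noteq> {}"
    using n3 by (simp add: lessThan_empty_iff)
  then show ?thesis
    unfolding graph_diam_def verts_cycle_graph by (simp add: eccentricity_cycle_graph)
qed

text \<open>On a cycle the diameter and all eccentricities equal \<open>n div 2\<close>, so the two
  caps on \<open>f\<close> collapse into one.\<close>

lemma packing_broadcast_cycle_graph_iff:
  "packing_broadcast (with_proj (cycle_graph n)) f \<longleftrightarrow>
     (\<forall>v<n. f v \<le> n div 2) \<and>
     (\<forall>u<n. \<forall>v<n. \<forall>w<n. f v > 0 \<longrightarrow> f w > 0 \<longrightarrow>
        cyc_dist n u v \<le> f v \<longrightarrow> cyc_dist n u w \<le> f w \<longrightarrow> v = w)"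
proof -
  have heard: "heard (with_proj (cycle_graph n)) f u =
      {v. v < n \<and> f v > 0 \<and> cyc_dist n u v \<le> f v}" if "u < n" for u
    using that
    by (auto simp: heard_def broadcast_verts_def verts_cycle_graph graph_dist_cycle_graph
             simp del: with_proj_simps)
  have "card (heard (with_proj (cycle_graph n)) f u) \<le> 1 \<longleftrightarrow>
      (\<forall>v<n. \<forall>w<n. f v > 0 \<longrightarrow> f w > 0 \<longrightarrow>
         cyc_dist n u v \<le> f v \<longrightarrow> cyc_dist n u w \<le> f w \<longrightarrow> v = w)" if "u < n" for u
    unfolding heard[OF that] One_nat_def by (subst card_le_Suc0_iff_eq) auto
  then show ?thesis
    by (auto simp: packing_broadcast_def broadcast_def verts_cycle_graph
        eccentricity_cycle_graph graph_diam_cycle_graph simp del: with_proj_simps)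
qed

text \<open>Maximality has to be tested only against raising one value by 1: balls of a larger
  \<open>g\<close> contain those of \<open>f\<close>, so a collision after the smallest increase
  persists in \<open>g\<close>. Vertices already at the cap are exempt.\<close>

lemma maximal_packing_broadcast_cycle_graph_iff:
  "maximal_packing_broadcast (with_proj (cycle_graph n)) f \<longleftrightarrow>
     packing_broadcast (with_proj (cycle_graph n)) f \<and>
     (\<forall>v<n. f v < n div 2 \<longrightarrow>
        (\<exists>y<n. \<exists>w<n. w \<noteq> v \<and> f w > 0 \<and> cyc_dist n y v \<le> Suc (f v) \<and> cyc_dist n y w \<le> f w))"
    (is "_ \<longleftrightarrow> _ \<and> ?blocked")
proof (intro iffI conjI)
  assume max: "maximal_packing_broadcast (with_proj (cycle_graph n)) f"
  then show pack: "packing_broadcast (with_proj (cycle_graph n)) f"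
    by (simp add: maximal_packing_broadcast_def)
  show ?blocked
  proof (intro allI impI)
    fix v assume v: "v < n" "f v < n div 2"
    let ?g = "f(v := Suc (f v))"
    have "\<not> packing_broadcast (with_proj (cycle_graph n)) ?g"
      using max v unfolding maximal_packing_broadcast_def verts_cycle_graph by fastforce
    moreover have "?g u \<le> n div 2" if "u < n" for u
      using pack v that unfolding packing_broadcast_cycle_graph_iff by auto
    ultimately obtain y a b where ab: "y < n" "a < n" "b < n" "?g a > 0" "?g b > 0" "cyc_dist n y a \<le> ?g a"
        "cyc_dist n y b \<le> ?g b" "a \<noteq> b"
      unfolding packing_broadcast_cycle_graph_iff by blast
    \<comment> \<open>A collision away from \<open>v\<close> would already be a collision of
      \<open>f\<close>.\<close>
    have "a = v \<or> b = v"
    proof (rule ccontr)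
      assume "\<not> ?thesis"
      then show False
        using ab pack unfolding packing_broadcast_cycle_graph_iff by auto
    qed
    then show "\<exists>y<n. \<exists>w<n. w \<noteq> v \<and> f w > 0 \<and> cyc_dist n y v \<le> Suc (f v) \<and> cyc_dist n y w \<le> f w"
      using ab by (auto split: if_splits)
  qed
next
  assume *: "packing_broadcast (with_proj (cycle_graph n)) f \<and> ?blocked"
  show "maximal_packing_broadcast (with_proj (cycle_graph n)) f"
    unfolding maximal_packing_broadcast_def
  proof (intro conjI notI)
    show "packing_broadcast (with_proj (cycle_graph n)) f" using * by blast
    assume "\<exists>g. packing_broadcast (with_proj (cycle_graph n)) g \<and>
        (\<exists>v\<in>verts (with_proj (cycle_graph n)). g v \<noteq> f v) \<and>
        (\<forall>v\<in>verts (with_proj (cycle_graph n)). f v \<le> g v)"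
    then obtain g v where g: "packing_broadcast (with_proj (cycle_graph n)) g"
        "v < n" "g v \<noteq> f v" "\<And>u. u < n \<Longrightarrow> f u \<le> g u"
      unfolding verts_cycle_graph by auto
    then have gv: "Suc (f v) \<le> g v"
      by (metis le_neq_implies_less Suc_leI)
    moreover have "g v \<le> n div 2"
      using g unfolding packing_broadcast_cycle_graph_iff by blast
    ultimately obtain y w where yw: "y < n" "w < n" "w \<noteq> v" "f w > 0"
        "cyc_dist n y v \<le> Suc (f v)" "cyc_dist n y w \<le> f w"
      using * g(2) by (meson Suc_le_lessD order_less_le_trans)
    have "g w > 0" "g v > 0" "cyc_dist n y v \<le> g v" "cyc_dist n y w \<le> g w"
      using yw g(4)[of w] gv by auto
    then have "v = w"
      using g(1,2) yw unfolding packing_broadcast_cycle_graph_iff by blast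
    then show False using yw by simp
  qed
qed

section \<open>Lower bound: how many vertices a maximal packing broadcast of given cost can
  serve\<close>

lemma order_le_of_maximal_packing_broadcast:
  assumes max: "maximal_packing_broadcast (with_proj (cycle_graph n)) f"
  defines "F \<equiv> broadcast_cost (with_proj (cycle_graph n)) f"
  shows "n \<le> 3 * F + 2 * (F div 2)"
proof -
  define V where "V = {v. v < n \<and> f v > 0}"
  define ball where "ball v = {u. u < n \<and> cyc_dist n u v \<le> f v}" for v
  define U where "U = {..<n} - (\<Union>v\<in>V. ball v)"
  let ?s = "cyc_succ n"
  have fin: "finite V" "finite U" "\<And>v. finite (ball v)"
    by (auto simp: V_def U_def ball_def)
  have blocked: "\<exists>y<n. \<exists>w<n. w \<noteq> v \<and> f w > 0 \<and> cyc_dist n y v \<le> Suc (f v) \<and> cyc_dist n y w \<le> f w"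
    if "v < n" "f v < n div 2" for v
    using max that unfolding maximal_packing_broadcast_cycle_graph_iff by blast
  have pack: "v = w" if "u < n" "v < n" "w < n" "f v > 0" "f w > 0"
      "cyc_dist n u v \<le> f v" "cyc_dist n u w \<le> f w" for u v w
    using max that
    unfolding maximal_packing_broadcast_cycle_graph_iff packing_broadcast_cycle_graph_iff by blast
  have F: "F = (\<Sum>v\<in>V. f v)"
    unfolding F_def broadcast_cost_def verts_cycle_graph
    by (rule sum.mono_neutral_right) (auto simp: V_def)
  have inU: "u < n \<and> (\<forall>v\<in>V. \<not> cyc_dist n u v \<le> f v)" if "u \<in> U" for u
    using that by (auto simp: U_def ball_def)
  have notinU: "\<exists>v\<in>V. cyc_dist n u v \<le> f v" if "u < n" "u \<notin> U" for u
    using that by (auto simp: U_def ball_def)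
  have V_le_F: "card V \<le> F"
    unfolding F card_eq_sum by (rule sum_mono) (auto simp: V_def)
  have n_le: "n \<le> 2 * F + card V + card U"
  proof -
    have "{..<n} \<subseteq> (\<Union>v\<in>V. ball v) \<union> U"
      by (auto simp: U_def)
    then have "card {..<n} \<le> card ((\<Union>v\<in>V. ball v) \<union> U)"
      using fin by (intro card_mono) auto
    also have "\<dots> \<le> card (\<Union>v\<in>V. ball v) + card U"
      by (rule card_Un_le)
    also have "card (\<Union>v\<in>V. ball v) \<le> (\<Sum>v\<in>V. card (ball v))"
      using fin(1) by (rule card_UN_le)
    also have "\<dots> \<le> (\<Sum>v\<in>V. 2 * f v + 1)"
      unfolding ball_def by (rule sum_mono, rule card_cyc_ball_le) (auto simp: V_def)
    also have "\<dots> = 2 * F + card V"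
      by (simp only: F sum.distrib sum_distrib_left card_eq_sum)
    finally show ?thesis by simp
  qed
  \<comment> \<open>\<open>UR\<close> and \<open>UL\<close> hold the first and last vertices of the
    runs of \<open>U\<close>; they lie just right, respectively just left, of a ball.
    \<open>A\<close> and \<open>B\<close> are the centres of balls with a vertex of \<open>U\<close>
    beyond the right, respectively left, end.\<close>
  define UR where "UR = U - ?s ` U"
  define UL where "UL = {u \<in> U. ?s u \<notin> U}"
  define A where "A = {v \<in> V. cyc_right n v (Suc (f v)) \<in> U}"
  define B where "B = {v \<in> V. cyc_left n v (Suc (f v)) \<in> U}"
  have inj: "inj_on ?s U"
    using inj_on_cyc_succ by (rule inj_on_subset) (auto simp: U_def)
  have U_sub: "U \<subseteq> UL \<union> UR"
  proof
    fix u assume u: "u \<in> U"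
    then have "u < n" using inU by blast
    \<comment> \<open>As 0 is below the cap, maximality forbids raising \<open>u\<close> to strength
      1, so some ball must come within distance 1 of \<open>u\<close>.\<close>
    have "f u = 0"
      using inU[OF u] by (auto simp: V_def)
    moreover have "0 < n div 2" using n3 by simp
    ultimately obtain y w where yw: "y < n" "w < n" "f w > 0" "cyc_dist n y u \<le> 1"
        "cyc_dist n y w \<le> f w"
      using blocked[OF \<open>u < n\<close>] by auto
    then have "y \<notin> U"
      using inU by (auto simp: V_def)
    then consider "y = ?s u" | "u = ?s y"
      using cyc_dist_le_1_cases[OF \<open>u < n\<close> yw(1,4)] u by blast
    then show "u \<in> UL \<union> UR"
    proof cases
      case 1
      then show ?thesis using u \<open>y \<notin> U\<close> by (simp add: UL_def)
    next
      case 2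
      have "u \<notin> ?s ` U"
      proof
        assume "u \<in> ?s ` U"
        then obtain x where "x \<in> U" "?s x = ?s y" using 2 by auto
        then have "x = y"
          using inU[of x] yw(1) inj_on_cyc_succ by (auto dest: inj_onD)
        then show False using \<open>x \<in> U\<close> \<open>y \<notin> U\<close> by simp
      qed
      then show ?thesis using u by (simp add: UR_def)
    qed
  qed
  have UR_sub: "UR \<subseteq> (\<lambda>v. cyc_right n v (Suc (f v))) ` A"
  proof
    fix u assume "u \<in> UR"
    then have u: "u \<in> U" "u \<notin> ?s ` U" "u < n" using inU by (auto simp: UR_def)
    obtain p where p: "p < n" "u = ?s p" using cyc_succ_surj[OF u(3)] .
    then have "p \<notin> U" using u by blast
    then obtain v where v: "v \<in> V" "cyc_dist n p v \<le> f v" using notinU p by blast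
    then have "u = cyc_right n v (Suc (f v))"
      using cyc_succ_leaves_ball[of p n v "f v"] p inU[OF u(1)] by (auto simp: V_def)
    then show "u \<in> (\<lambda>v. cyc_right n v (Suc (f v))) ` A"
      using v(1) u(1) unfolding A_def by blast
  qed
  have UL_sub: "UL \<subseteq> (\<lambda>v. cyc_left n v (Suc (f v))) ` B"
  proof
    fix u assume "u \<in> UL"
    then have u: "u \<in> U" "?s u \<notin> U" "u < n" using inU by (auto simp: UL_def)
    then obtain v where v: "v \<in> V" "cyc_dist n (?s u) v \<le> f v"
      using notinU cyc_succ_less by blast
    then have "u = cyc_left n v (Suc (f v))"
      using cyc_succ_enters_ball[of u n v "f v"] inU[OF u(1)] by (auto simp: V_def)
    then show "u \<in> (\<lambda>v. cyc_left n v (Suc (f v))) ` B"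
      using v(1) u(1) unfolding B_def by blast
  qed
  \<comment> \<open>Raising the strength of \<open>v\<close> by 1 adds at most the two vertices just
    beyond its ends. If both hear nothing, no collision arises, against maximality.\<close>
  have disj: "A \<inter> B = {}"
  proof (rule ccontr)
    assume "A \<inter> B \<noteq> {}"
    then obtain v where v: "v < n" "f v > 0" "cyc_right n v (Suc (f v)) \<in> U"
        "cyc_left n v (Suc (f v)) \<in> U"
      by (auto simp: A_def B_def V_def)
    define u where "u = cyc_right n v (Suc (f v))"
    have "u < n" "\<not> cyc_dist n u v \<le> f v"
      using inU[of u] v by (auto simp: u_def V_def)
    \<comment> \<open>A vertex outside the ball of \<open>v\<close> shows that \<open>v\<close> is
      not at the cap, so \<open>blocked\<close> applies.\<close>
    then have "f v < n div 2"
      using cyc_dist_le_half[of u n v] v(1) by linarith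
    then obtain y w where yw: "y < n" "w < n" "w \<noteq> v" "f w > 0" "cyc_dist n y v \<le> Suc (f v)"
        "cyc_dist n y w \<le> f w"
      using blocked v(1) by blast
    then have "\<not> cyc_dist n y v \<le> f v"
      using pack[of y v w] v by auto
    then have "y = cyc_left n v (Suc (f v)) \<or> y = cyc_right n v (Suc (f v))"
      using yw v(1) by (intro cyc_sphere) auto
    then have "y \<in> U" using v by auto
    then show False using inU yw by (auto simp: V_def)
  qed
  have AB: "finite A" "finite B" "A \<union> B \<subseteq> V"
    using fin(1) by (auto simp: A_def B_def)
  have "card A + card B \<le> card V"
    using card_Un_disjoint[OF AB(1,2) disj] card_mono[OF fin(1) AB(3)] by simp
  moreover have "card UR \<le> card A" "card UL \<le> card B"
    using surj_card_le[OF AB(1) UR_sub] surj_card_le[OF AB(2) UL_sub] by auto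
  moreover have "card UR = card UL"
    unfolding UR_def UL_def using fin(2) inj by (rule card_inj_boundary_eq)
  moreover have "card U \<le> card UL + card UR"
    using card_mono[OF _ U_sub] card_Un_le[of UL UR] fin(2) by (simp add: UL_def UR_def)
  \<comment> \<open>The bound on \<open>card U\<close> is twice the integer \<open>card UL\<close>;
    its evenness is what yields \<open>2 * (F div 2)\<close> rather than \<open>F\<close>.\<close>
  ultimately have "n \<le> 3 * F + 2 * card UL" "2 * card UL \<le> F"
    using n_le V_le_F by linarith+
  moreover from this have "card UL \<le> F div 2"
    by (simp add: less_eq_div_iff_mult_less_eq)
  ultimately show ?thesis by linarith
qed

section \<open>Upper bound: explicit maximal packing broadcasts\<close>

lemma maximal_packing_broadcast_single:
  "maximal_packing_broadcast (with_proj (cycle_graph n)) (\<lambda>v. if v = 0 then n div 2 else 0)"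
  unfolding maximal_packing_broadcast_cycle_graph_iff packing_broadcast_cycle_graph_iff
proof (intro conjI allI impI)
  fix v show "(if v = 0 then n div 2 else 0) \<le> n div 2" by simp
next
  fix v w :: nat assume "0 < (if v = 0 then n div 2 else 0)" "0 < (if w = 0 then n div 2 else 0)"
  then show "v = w" by presburger
next
  fix v assume v: "v < n" "(if v = 0 then n div 2 else 0) < n div 2"
  \<comment> \<open>Vertex 0 is at the cap and reaches every vertex, so any other \<open>v\<close>
    is itself the place of collision.\<close>
  then show "\<exists>y<n. \<exists>w<n. w \<noteq> v \<and> 0 < (if w = 0 then n div 2 else 0) \<and>
      cyc_dist n y v \<le> Suc (if v = 0 then n div 2 else 0) \<and>
      cyc_dist n y w \<le> (if w = 0 then n div 2 else 0)"
    using n3 cyc_dist_le_half[of v n 0]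
    by (intro exI[of _ v], intro conjI exI[of _ 0]) (auto split: if_splits)
qed

text \<open>Balls of radius 1 are disjoint when centres are at least 3 apart along both arcs, hence
  the two inequalities in \<open>spaced\<close>. Raising a vertex off \<open>S\<close> to 1 meets a
  ball within distance 1 + 1; raising one in \<open>S\<close> to 2 meets a ball within 2 +
  1.\<close>

lemma maximal_packing_broadcast_indicator:
  assumes "S \<subseteq> {..<n}"
    and spaced: "\<And>v w. v \<in> S \<Longrightarrow> w \<in> S \<Longrightarrow> v < w \<Longrightarrow> v + 3 \<le> w \<and> w + 3 \<le> n + v"
    and near: "\<And>v. v < n \<Longrightarrow> \<exists>w\<in>S. w \<noteq> v \<and> cyc_dist n v w \<le> (if v \<in> S then 3 else 2)"
  shows "maximal_packing_broadcast (with_proj (cycle_graph n)) (\<lambda>v. if v \<in> S then 1 else 0)"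
  unfolding maximal_packing_broadcast_cycle_graph_iff packing_broadcast_cycle_graph_iff
proof (intro conjI allI impI)
  fix v show "(if v \<in> S then 1 else 0) \<le> n div 2" using n3 by auto
next
  fix u v w assume "u < n" "v < n" "w < n" "0 < (if v \<in> S then 1 else 0 :: nat)"
    "0 < (if w \<in> S then 1 else 0 :: nat)"
    "cyc_dist n u v \<le> (if v \<in> S then 1 else 0)" "cyc_dist n u w \<le> (if w \<in> S then 1 else 0)"
  then have vw: "u < n" "v < n" "w < n" "v \<in> S" "w \<in> S" "cyc_dist n u v \<le> 1" "cyc_dist n u w \<le> 1"
    by (auto split: if_splits)
  show "v = w"
    using spaced[of v w] spaced[of w v] vw(1-5) vw(6)[unfolded cyc_dist_le_iff[OF vw(1,2)]]
      vw(7)[unfolded cyc_dist_le_iff[OF vw(1,3)]]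
    using [[smt_nat_as_int]] by (smt (verit))
next
  fix v assume v: "v < n"
  obtain w where w: "w \<in> S" "w \<noteq> v" "cyc_dist n v w \<le> (if v \<in> S then 3 else 2)"
    using near[OF v] by blast
  then have "cyc_dist n v w \<le> Suc (if v \<in> S then 1 else 0) + 1"
    by (auto split: if_splits)
  moreover have "w < n" using w(1) assms(1) by auto
  ultimately have "\<exists>y<n. cyc_dist n y v \<le> Suc (if v \<in> S then 1 else 0) \<and> cyc_dist n y w \<le> 1"
    using v by (intro cyc_dist_split)
  then show "\<exists>y<n. \<exists>w<n. w \<noteq> v \<and> 0 < (if w \<in> S then 1 else 0 :: nat) \<and>
      cyc_dist n y v \<le> Suc (if v \<in> S then 1 else 0) \<and> cyc_dist n y w \<le> (if w \<in> S then 1 else 0)"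
    using w \<open>w < n\<close> by (metis zero_less_one)
qed

lemma broadcast_cost_indicator:
  assumes "S \<subseteq> {..<n}"
  shows "broadcast_cost (with_proj (cycle_graph n)) (\<lambda>v. if v \<in> S then 1 else 0) = card S"
  using assms unfolding broadcast_cost_def verts_cycle_graph
  by (simp add: sum.If_cases Int_absorb1)

text \<open>Positions 0 and 3 of each block of eight hear-balls cover all but positions 5 and 6, at
  cost 2. \<open>T\<close> repairs the end of the cycle, and the last block may lack up to two
  vertices. Its positions 6 and 7 are left to \<open>tail\<close>, since \<open>8 * q\<close> need
  not carry a broadcast.\<close>

lemma maximal_packing_broadcast_zero_three:
  fixes q :: nat and T :: "nat set"
  defines "S \<equiv> (\<lambda>i. 8 * i) ` {..<q} \<union> (\<lambda>i. 8 * i + 3) ` {..<q} \<union> T"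
  assumes "q > 0" and "8 * q \<le> n + 2"
    and T_lower: "\<And>t. t \<in> T \<Longrightarrow> 8 * q \<le> t + 2 \<and> t + 3 \<le> n"
    and T_spaced: "\<And>t t'. t \<in> T \<Longrightarrow> t' \<in> T \<Longrightarrow> t < t' \<Longrightarrow> t + 3 \<le> t'"
    and tail: "\<And>v. v < n \<Longrightarrow> 8 * q \<le> v + 2 \<Longrightarrow>
      \<exists>w\<in>insert 0 T. w \<noteq> v \<and> cyc_dist n v w \<le> (if v \<in> T then 3 else 2)"
  shows "\<exists>f. maximal_packing_broadcast (with_proj (cycle_graph n)) f \<and>
    broadcast_cost (with_proj (cycle_graph n)) f \<le> 2 * q + card T"
proof -
  let ?B = "(\<lambda>i. 8 * i) ` {..<q} \<union> (\<lambda>i. 8 * i + 3) ` {..<q}"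
  have B_upper: "v + 5 \<le> 8 * q" if "v \<in> ?B" for v
    using that by auto
  have B_spaced: "v + 3 \<le> w" if vw: "v \<in> ?B" "w \<in> ?B" "v < w" for v w
  proof -
    obtain i j where "v = 8 * i \<or> v = 8 * i + 3" "w = 8 * j \<or> w = 8 * j + 3"
      using vw(1,2) by blast
    then show ?thesis
      using vw(3) by (cases i j rule: linorder_cases) (elim disjE; linarith)+
  qed
  have S_sub: "S \<subseteq> {..<n}"
    using B_upper assms(3) T_lower unfolding S_def by fastforce
  have "card S \<le> 2 * q + card T"
  proof -
    have "card ?B \<le> card ((\<lambda>i. 8 * i) ` {..<q}) + card ((\<lambda>i. 8 * i + 3) ` {..<q})"
      by (rule card_Un_le)
    also have "\<dots> \<le> q + q"
      by (intro add_mono order.trans[OF card_image_le]) auto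
    finally show ?thesis
      unfolding S_def using card_Un_le[of ?B T] by linarith
  qed
  moreover have "maximal_packing_broadcast (with_proj (cycle_graph n)) (\<lambda>v. if v \<in> S then 1 else 0)"
  proof (rule maximal_packing_broadcast_indicator[OF S_sub])
    fix v w assume vw: "v \<in> S" "w \<in> S" "v < w"
    then consider "v \<in> ?B" "w \<in> ?B" | "v \<in> ?B" "w \<in> T" | "v \<in> T" "w \<in> ?B" | "v \<in> T" "w \<in> T"
      unfolding S_def by blast
    then show "v + 3 \<le> w \<and> w + 3 \<le> n + v"
    proof cases
      case 1
      show ?thesis
        using B_spaced[OF 1 vw(3)] B_upper[OF 1(2)] assms(3) by linarith
    next
      case 2
      show ?thesis using B_upper[OF 2(1)] T_lower[OF 2(2)] by linarith
    next
      case 3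
      show ?thesis using B_upper[OF 3(2)] T_lower[OF 3(1)] vw(3) by linarith
    next
      case 4
      show ?thesis using T_spaced[OF 4 vw(3)] T_lower[OF 4(2)] by linarith
    qed
  next
    fix v assume v: "v < n"
    show "\<exists>w\<in>S. w \<noteq> v \<and> cyc_dist n v w \<le> (if v \<in> S then 3 else 2)"
    proof (cases "8 * q \<le> v + 2")
      case True
      have "0 \<in> S" using assms(2) by (auto simp: S_def image_iff)
      moreover have "v \<notin> ?B" using B_upper[of v] True by linarith
      ultimately show ?thesis
        using tail[OF v True] unfolding S_def by auto
    next
      case False
      define i where "i = v div 8"
      \<comment> \<open>Within a block, 0 and 3 serve each other and positions up to 5 use one of
        these. Positions 6 and 7 use the next block, which exists because
        \<open>v + 2 < 8 * q\<close>.\<close>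
      obtain w where w: "w \<in> ?B" "w \<noteq> v" "v \<le> w + 3" "w \<le> v + 3"
          "v \<in> ?B \<or> v \<le> w + 2 \<and> w \<le> v + 2"
      proof -
        have "v = 8 * i + v mod 8" "v mod 8 < 8"
          by (simp_all add: i_def)
        then consider "v = 8 * i" | "v = 8 * i + 1" | "v = 8 * i + 2" | "v = 8 * i + 3"
          | "v = 8 * i + 4" | "v = 8 * i + 5" | "v = 8 * i + 6" | "v = 8 * i + 7"
          by linarith
        moreover have "8 * i \<in> ?B" "8 * i + 3 \<in> ?B"
          using False \<open>v = 8 * i + v mod 8\<close> by auto
        moreover have "8 * Suc i \<in> ?B" if "8 * i + 6 \<le> v"
          using False that by (intro UnI1 imageI) simp
        ultimately show thesis
          using that[of "8 * i"] that[of "8 * i + 3"] that[of "8 * Suc i"] by cases auto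
      qed
      moreover from this have "w < n" using S_sub unfolding S_def by blast
      ultimately show ?thesis
        using v by (intro bexI[of _ w]) (auto simp: cyc_dist_le_iff S_def simp del: Un_iff image_iff)
    qed
  qed
  ultimately show ?thesis
    using broadcast_cost_indicator[OF S_sub] by metis
qed

lemma maximal_packing_broadcast_cheap:
  "\<exists>f. maximal_packing_broadcast (with_proj (cycle_graph n)) f \<and>
    broadcast_cost (with_proj (cycle_graph n)) f \<le>
      (if n mod 8 = 0 then n div 4
       else if n mod 8 \<in> {1, 2, 3} then 2 * (n div 8) + 1
       else 2 * (n div 8) + 2)" (is "\<exists>f. _ \<and> _ \<le> ?rhs")
proof -
  define m where "m = n div 8"
  define r where "r = n mod 8"
  have n: "n = 8 * m + r" "r < 8" by (simp_all add: m_def r_def)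
  have rhs: "?rhs = 2 * m + (if r = 0 then 0 else if r \<le> 3 then 1 else 2)"
    unfolding m_def r_def by (rule cost_formula_eq)
  consider "n < 6" | "n \<ge> 6" "r \<in> {0, 6, 7}" | "n \<ge> 6" "r \<in> {1, 2, 3}" | "n \<ge> 6" "r \<in> {4, 5}"
    using n(2) by fastforce
  then show ?thesis
  proof cases
    case 1
    have "broadcast_cost (with_proj (cycle_graph n)) (\<lambda>v. if v = 0 then n div 2 else 0) = n div 2"
      unfolding broadcast_cost_def verts_cycle_graph using n3 by (simp add: sum.delta)
    \<comment> \<open>Here \<open>n div 2\<close> is 1, 2, 2, in agreement with the formula.\<close>
    moreover have "n = 3 \<or> n = 4 \<or> n = 5" using 1 n3 by linarith
    then have "n div 2 \<le> ?rhs" by auto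
    ultimately show ?thesis using maximal_packing_broadcast_single by metis
  next
    case 2
    \<comment> \<open>For residues 6 and 7 a truncated extra block still has room for its positions
      0 and 3.\<close>
    define q where "q = (if r = 0 then m else m + 1)"
    have q: "q > 0" "8 * q \<le> n + 2" "n \<le> 8 * q" "2 * q + card ({} :: nat set) \<le> ?rhs"
      using 2 n unfolding rhs q_def by auto
    have "\<exists>f. maximal_packing_broadcast (with_proj (cycle_graph n)) f \<and>
        broadcast_cost (with_proj (cycle_graph n)) f \<le> 2 * q + card ({} :: nat set)"
      using q 2 by (intro maximal_packing_broadcast_zero_three) (auto simp: cyc_dist_le_iff)
    then show ?thesis using q(4) order.trans by blast
  next
    case 3
    \<comment> \<open>\<open>n - 3\<close> is the last position far enough from 0 across the wrap;
      it lies between 8m - 2 and 8m, so it also clears the last block.\<close>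
    have m: "m > 0" "8 * m < n" "n \<le> 8 * m + 3" "2 * m + card {n - 3} \<le> ?rhs"
      using 3 n unfolding rhs by auto
    have "\<exists>f. maximal_packing_broadcast (with_proj (cycle_graph n)) f \<and>
        broadcast_cost (with_proj (cycle_graph n)) f \<le> 2 * m + card {n - 3}"
    proof (rule maximal_packing_broadcast_zero_three)
      fix v assume v: "v < n" "8 * m \<le> v + 2"
      show "\<exists>w\<in>{0, n - 3}. w \<noteq> v \<and> cyc_dist n v w \<le> (if v \<in> {n - 3} then 3 else 2)"
      proof (cases "v + 3 < n")
        case True
        then have "n - 3 \<noteq> v" "cyc_dist n v (n - 3) \<le> 2"
          using v m by (auto simp: cyc_dist_le_iff)
        then show ?thesis using True by auto
      next
        case False
        then have "0 \<noteq> v" "cyc_dist n v 0 \<le> (if v \<in> {n - 3} then 3 else 2)"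
          using v m 3 by (auto simp: cyc_dist_le_iff)
        then show ?thesis by blast
      qed
    qed (use m 3 in auto)
    then show ?thesis using m(4) order.trans by blast
  next
    case big: 4
    \<comment> \<open>One extra vertex would leave too long a gap; \<open>n - 6\<close> and
      \<open>n - 3\<close> continue at spacing 3, and \<open>n - 6\<close> is 8m - 2 or 8m -
      1.\<close>
    have m: "m > 0" "8 * m + 4 \<le> n" "n \<le> 8 * m + 5"
      using big n by auto
    have card: "2 * m + card {n - 6, n - 3} \<le> ?rhs"
      using big unfolding rhs by (auto simp: card_insert_if)
    have "\<exists>f. maximal_packing_broadcast (with_proj (cycle_graph n)) f \<and>
        broadcast_cost (with_proj (cycle_graph n)) f \<le> 2 * m + card {n - 6, n - 3}"
    proof (rule maximal_packing_broadcast_zero_three)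
      fix v assume v: "v < n" "8 * m \<le> v + 2"
      have witness: "\<exists>w\<in>{0, n - 6, n - 3}. w \<noteq> v \<and>
          cyc_dist n v w \<le> (if v \<in> {n - 6, n - 3} then 3 else 2)"
        if "w \<in> {0, n - 6, n - 3}" "w \<noteq> v" "cyc_dist n v w \<le> (if v \<in> {n - 6, n - 3} then 3 else 2)" for w
        using that by blast
      consider "v + 6 < n" | "v + 6 = n" | "v + 5 = n" | "v + 4 = n" | "v + 3 \<ge> n"
        by linarith
      then show "\<exists>w\<in>{0, n - 6, n - 3}. w \<noteq> v \<and>
          cyc_dist n v w \<le> (if v \<in> {n - 6, n - 3} then 3 else 2)"
      proof cases
        case 1
        then show ?thesis using v m by (intro witness[of "n - 6"]) (auto simp: cyc_dist_le_iff)
      next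
        case 2
        then show ?thesis by (intro witness[of "n - 3"]) (auto simp: cyc_dist_le_iff)
      next
        case 3
        then show ?thesis using big(1) by (intro witness[of "n - 6"]) (auto simp: cyc_dist_le_iff)
      next
        case 4
        then show ?thesis by (intro witness[of "n - 3"]) (auto simp: cyc_dist_le_iff)
      next
        case 5
        then show ?thesis using v m by (intro witness[of 0]) (auto simp: cyc_dist_le_iff)
      qed
    qed (use m big in auto)
    then show ?thesis using card order.trans by blast
  qed
qed

end

theorem theorem3p17:
  fixes n :: nat
  assumes "n \<ge> 3"
  shows "lower_broadcast_packing_number (with_proj (cycle_graph n)) =
    (if n mod 8 = 0 then n div 4
     else if n mod 8 \<in> {1, 2, 3} then 2 * (n div 8) + 1
     else 2 * (n div 8) + 2)" (is "_ = ?rhs")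
proof -
  let ?costs = "{broadcast_cost (with_proj (cycle_graph n)) f |f.
    maximal_packing_broadcast (with_proj (cycle_graph n)) f}"
  have lower: "?rhs \<le> F" if "F \<in> ?costs" for F
  proof -
    from that have "n \<le> 3 * F + 2 * (F div 2)"
      using order_le_of_maximal_packing_broadcast[OF assms] by blast
    then have "8 * (n div 8) + n mod 8 \<le> 3 * F + 2 * (F div 2)"
      by simp
    then show ?thesis
      unfolding cost_formula_eq by (rule cost_bound_of_order_bound)
  qed
  \<comment> \<open>An attained cost makes the set nonempty, so its infimum is a true minimum and
    not the default 0.\<close>
  obtain F where F: "F \<in> ?costs" "F \<le> ?rhs"
    using maximal_packing_broadcast_cheap[OF assms] by blast
  then have "F = ?rhs"
    by (intro order.antisym[OF F(2)] lower)
  then show ?thesis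
    unfolding lower_broadcast_packing_number_def using F(1) lower
    by (intro cInf_eq_minimum) auto
qed

end
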